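(* Fix probabilities $p_1,p_2>0$ with $p_1+p_2=1$. (a) There is a non-factorable pair $\bar{\mathcal{A}}=\{A_1,A_2\}$ of real $2\times2$ matrices such that for every real-valued function $\varphi$ on the set of all non-factorable pairs of $2\times2$ matrices which is continuous at the point $\bar{\mathcal{A}}$ and satisfies $\varphi(\mathcal{A})\le\rho(\mathcal{A})$ for every non-factorable pair $\mathcal{A}$, we have $\varphi(\bar{\mathcal{A}})\le\rho(\bar{\mathcal{A}})-1$. (b) There is a cone $K\subset\mathbb{R}^3$ and a non-factorable pair $\bar{\mathcal{A}}=\{A_1,A_2\}$ of real $3\times3$ matrices sharing the invariant cone $K$ such that for every real-valued function $\varphi$ on the set of all non-factorable pairs of $3\times3$ matrices sharing the invariant cone $K$ which is continuous at the point $\bar{\mathcal{A}}$ and satisfies $\varphi(\mathcal{A})\le\rho(\mathcal{A})$ for every such pair $\mathcal{A}$, we have $\varphi(\bar{\mathcal{A}})\le\rho(\bar{\mathcal{A}})-1$.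
   Context: A pair $\mathcal{A}=\{A_1,A_2\}$ of real $d\times d$ matrices (regarded as an ordered pair, with the usual topology of $(\mathbb{R}^{d\times d})^2$) is non-factorable if $A_1,A_2$ have no common invariant linear subspace of $\mathbb{R}^d$ other than $\{0\}$ and $\mathbb{R}^d$. A cone is a convex, closed, solid (nonempty interior), pointed cone with apex at the origin; the pair shares the invariant cone $K$ if $A_1K\subset K$ and $A_2K\subset K$. The Lyapunov radius is $\rho(\mathcal{A})=e^{\lambda(\mathcal{A})}$ with $e^{-\infty}=0$, where $$\lambda(\mathcal{A})=\lim_{k\to\infty}\frac1k\sum_{d_1,\dots,d_k\in\{1,2\}}p_{d_1}\cdots p_{d_k}\log\|A_{d_k}\cdots A_{d_1}\|\in[-\infty,\infty),$$ with $\log0=-\infty$, is the Lyapunov exponent. *)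

theory Defs
  imports "HOL-Analysis.Analysis"
begin

definition pair_nth :: "'a \<times> 'a \<Rightarrow> nat \<Rightarrow> 'a"
  where "pair_nth a d = (if d = 1 then fst a else snd a)"

definition nonfactorable :: "(real^'n^'n) \<times> (real^'n^'n) \<Rightarrow> bool"
  where "nonfactorable A \<longleftrightarrow>
    (\<forall>V. subspace V \<and> (*v) (fst A) ` V \<subseteq> V \<and> (*v) (snd A) ` V \<subseteq> V \<longrightarrow> V = {0} \<or> V = UNIV)"

definition proper_cone :: "(real^'n) set \<Rightarrow> bool"
  where "proper_cone K \<longleftrightarrow>
    cone K \<and> convex K \<and> closed K \<and> interior K \<noteq> {} \<and> K \<inter> uminus ` K = {0}"

definition shares_cone :: "(real^'n) set \<Rightarrow> (real^'n^'n) \<times> (real^'n^'n) \<Rightarrow> bool"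
  where "shares_cone K A \<longleftrightarrow> (*v) (fst A) ` K \<subseteq> K \<and> (*v) (snd A) ` K \<subseteq> K"

(* The head of the list is applied first: [d1, ..., dk] yields A_dk ** ... ** A_d1. *)
fun word_matrix :: "(real^'n^'n) \<times> (real^'n^'n) \<Rightarrow> nat list \<Rightarrow> real^'n^'n"
  where
    "word_matrix A [] = mat 1"
  | "word_matrix A (d # ds) = word_matrix A ds ** pair_nth A d"

(* Logarithm of a nonnegative real, with log 0 = -\<infinity>; library ln has ln 0 = 0. *)
definition log_ext :: "real \<Rightarrow> ereal"
  where "log_ext x = (if x = 0 then -\<infinity> else ereal (ln x))"

(* The operator norm is used; the exponent does not depend on the choice of matrix norm. *)
definition lyapunov_exponent :: "real \<times> real \<Rightarrow> (real^'n^'n) \<times> (real^'n^'n) \<Rightarrow> ereal"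
  where "lyapunov_exponent p A = lim (\<lambda>k. ereal (1 / real k) *
    (\<Sum>w | length w = k \<and> set w \<subseteq> {1, 2}.
       ereal (prod_list (map (pair_nth p) w)) * log_ext (onorm ((*v) (word_matrix A w)))))"

definition lyapunov_radius :: "real \<times> real \<Rightarrow> (real^'n^'n) \<times> (real^'n^'n) \<Rightarrow> real"
  where "lyapunov_radius p A =
    (if lyapunov_exponent p A = -\<infinity> then 0 else exp (real_of_ereal (lyapunov_exponent p A)))"

end

(* In both dimensions A1 = 2 f f^T and A2 = 2 R with R a rotation, so A1 A2^k A1 is a multiple of
   f . R^k f. At a suitable angle of finite order all the numbers |f . R^k f| are at least 1/2, so
   every product stretches f by a factor of at least 1 and the Lyapunov radius is at least 1.
   Arbitrarily close angles have f . R^k f = 0 for some k; then a finite product vanishes with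
   positive probability and the radius is 0. *)

theory Submission
  imports Defs
begin

section \<open>Fekete's lemma for nonnegative subadditive sequences\<close>

text \<open>The limit is the infimum of the quotients, which exists because they are bounded below
  by 0. Dividing \<open>n\<close> with remainder by a fixed, nearly optimal \<open>m\<close> bounds
  \<open>a n / n\<close> by \<open>a m / m\<close> plus a constant over \<open>n\<close>.\<close>

lemma subadditive_quotient_tendsto:
  fixes a :: "nat \<Rightarrow> real"
  assumes sub: "\<And>m n. a (m + n) \<le> a m + a n" and nonneg: "\<And>n. 0 \<le> a n"
  obtains L where "0 \<le> L" "(\<lambda>n. a n / real n) \<longlonglongrightarrow> L"
proof
  let ?S = "(\<lambda>n. a n / real n) ` {1..}"
  define L where "L = Inf ?S"
  have bdd: "bdd_below ?S"
    by (rule bdd_belowI[of _ 0]) (auto simp: nonneg)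
  show "0 \<le> L"
    unfolding L_def by (rule cInf_greatest) (auto simp: nonneg)
  have lower: "L \<le> a n / real n" if "n \<ge> 1" for n
    unfolding L_def by (rule cInf_lower) (use that bdd in auto)
  have mult: "a (q * m + r) \<le> real q * a m + a r" for q m r
  proof (induction q)
    case (Suc q)
    have "a (Suc q * m + r) \<le> a m + a (q * m + r)"
      using sub[of m "q * m + r"] by (simp add: add.assoc)
    with Suc show ?case by (simp add: algebra_simps)
  qed simp
  show "(\<lambda>n. a n / real n) \<longlonglongrightarrow> L"
  proof (rule LIMSEQ_I)
    fix e :: real assume e: "e > 0"
    obtain m where m: "m \<ge> 1" "a m / real m < L + e / 2"
      using cInf_lessD[of ?S "L + e / 2"] e by (auto simp: L_def)
    \<comment> \<open>\<open>M\<close> dominates every remainder term \<open>a (n mod m)\<close>,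
      independently of \<open>n\<close>.\<close>
    define M where "M = (\<Sum>r<m. a r)"
    have M: "a r \<le> M" if "r < m" for r
      unfolding M_def by (rule member_le_sum) (use that nonneg in auto)
    obtain N where N: "M * 2 / e < real N" using reals_Archimedean2 by blast
    have "norm (a n / real n - L) < e" if n: "n \<ge> Suc N" for n
    proof -
      have n0: "real n > 0" using n by simp
      have "a n \<le> real (n div m) * a m + a (n mod m)"
        using mult[of "n div m" m "n mod m"] by simp
      also have "\<dots> \<le> (real n / real m) * a m + M"
        by (intro add_mono mult_right_mono nonneg M of_nat_div_le_of_nat) (use m in auto)
      finally have "a n / real n \<le> a m / real m + M / real n"
        using n0 m by (simp add: field_simps)
      moreover have "M / real n < e / 2"
      proof -
        have "M * 2 / e < real n" using N n by linarith
        then show ?thesis using e n0 by (simp add: field_simps)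
      qed
      moreover have "L \<le> a n / real n" using lower n by simp
      ultimately show ?thesis using m(2) unfolding real_norm_def by linarith
    qed
    then show "\<exists>N. \<forall>n\<ge>N. norm (a n / real n - L) < e" by blast
  qed
qed

section \<open>Words in two letters and their probabilities\<close>

definition words :: "nat \<Rightarrow> nat list set"
  where "words k = {w. length w = k \<and> set w \<subseteq> {1, 2}}"

lemma finite_words [simp]: "finite (words k)"
  using finite_lists_length_eq[of "{1, 2 :: nat}" k] by (simp add: words_def conj_commute)

lemma sum_words_append:
  "(\<Sum>w\<in>words (m + n). F w) = (\<Sum>v\<in>words m. \<Sum>w\<in>words n. F (v @ w))"
proof -
  have "bij_betw (\<lambda>(v, w). v @ w) (words m \<times> words n) (words (m + n))"
  proof (rule bij_betwI[where g = "\<lambda>w. (take m w, drop m w)"])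
    show "(\<lambda>w. (take m w, drop m w)) \<in> words (m + n) \<rightarrow> words m \<times> words n"
      by (auto simp: words_def dest!: in_set_takeD in_set_dropD)
  qed (auto simp: words_def)
  from sum.reindex_bij_betw[OF this, of F] show ?thesis
    by (simp add: sum.cartesian_product case_prod_unfold)
qed

lemma words_1: "words 1 = {[1], [2]}"
  by (auto simp: words_def length_Suc_conv)

text \<open>The weights form a product distribution: splitting off the first letter contributes a
  factor \<open>fst p + snd p\<close>.\<close>

lemma sum_words_prob:
  assumes "fst p + snd p = (1::real)"
  shows "(\<Sum>w\<in>words n. prod_list (map (pair_nth p) w)) = 1"
proof (induction n)
  case 0
  have "words 0 = {[]}" by (auto simp: words_def)
  then show ?case by simp
next
  case (Suc n)
  have "(\<Sum>w\<in>words (Suc n). prod_list (map (pair_nth p) w)) =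
      (pair_nth p 1 + pair_nth p 2) * (\<Sum>w\<in>words n. prod_list (map (pair_nth p) w))"
    using sum_words_append[where m = 1 and n = n and F = "\<lambda>w. prod_list (map (pair_nth p) w)"]
    by (simp add: words_1[simplified] sum_distrib_left[symmetric] distrib_right)
  also have "\<dots> = 1" using Suc assms by (simp only: Suc) (simp add: pair_nth_def)
  finally show ?case .
qed

lemma word_matrix_append:
  "word_matrix A (v @ w) = word_matrix A w ** word_matrix A v"
  by (induction v) (auto simp: matrix_mul_assoc)

lemma prob_word_pos:
  assumes "0 < fst p" "0 < snd (p :: real \<times> real)"
  shows "0 < prod_list (map (pair_nth p) w)"
  using assms by (induction w) (auto simp: pair_nth_def)

lemma lyapunov_exponent_words:
  "lyapunov_exponent p A = lim (\<lambda>k. ereal (1 / real k) *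
    (\<Sum>w\<in>words k. ereal (prod_list (map (pair_nth p) w)) * log_ext (onorm ((*v) (word_matrix A w)))))"
  by (simp add: lyapunov_exponent_def words_def)

section \<open>Criteria for radius at least 1 and radius 0\<close>

lemma onorm_matrix_mul_le:
  fixes A :: "real^'n^'m" and B :: "real^'k^'n"
  shows "onorm ((*v) (A ** B)) \<le> onorm ((*v) A) * onorm ((*v) B)"
  using onorm_compose[OF matrix_vector_mul_bounded_linear[of A] matrix_vector_mul_bounded_linear[of B]]
  by (simp add: o_def matrix_vector_mul_assoc)

text \<open>The value of \<open>lim\<close> is usable only once convergence is known. The vector
  \<open>x\<close> forces every norm to be at least 1, so all logarithms are finite and nonnegative.
  Submultiplicative norms and multiplicative weights make the averaged logarithm subadditive, and
  Fekete's lemma yields a nonnegative limit.\<close>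

lemma lyapunov_radius_ge_1:
  fixes A :: "(real^'n^'n) \<times> (real^'n^'n)"
  assumes p: "0 < fst p" "0 < snd p" "fst p + snd p = 1"
    and x: "x \<noteq> 0" and exp: "\<And>w. set w \<subseteq> {1, 2} \<Longrightarrow> norm x \<le> norm (word_matrix A w *v x)"
  shows "1 \<le> lyapunov_radius p A"
proof -
  let ?P = "\<lambda>w. prod_list (map (pair_nth p) w)"
  let ?N = "\<lambda>w. onorm ((*v) (word_matrix A w))"
  define a where "a k = (\<Sum>w\<in>words k. ?P w * ln (?N w))" for k
  have P: "0 < ?P w" for w using prob_word_pos p by blast
  have N: "1 \<le> ?N w" if "w \<in> words k" for w k
  proof -
    have "norm x \<le> ?N w * norm x"
      using exp[of w] onorm[OF matrix_vector_mul_bounded_linear, of "word_matrix A w" x] that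
      by (auto simp: words_def)
    then show ?thesis using x by simp
  qed
  have nonneg: "0 \<le> a k" for k
    unfolding a_def using N P by (intro sum_nonneg) (simp add: less_imp_le)
  have sub: "a (m + n) \<le> a m + a n" for m n
  proof -
    have "a (m + n) = (\<Sum>v\<in>words m. \<Sum>w\<in>words n. ?P (v @ w) * ln (?N (v @ w)))"
      unfolding a_def by (rule sum_words_append)
    also have "\<dots> \<le> (\<Sum>v\<in>words m. \<Sum>w\<in>words n. ?P v * ?P w * (ln (?N v) + ln (?N w)))"
    proof (intro sum_mono)
      fix v w assume v: "v \<in> words m" and w: "w \<in> words n"
      have vw: "v @ w \<in> words (m + n)" using v w by (auto simp: words_def)
      have "ln (?N (v @ w)) \<le> ln (?N w * ?N v)"
        using onorm_matrix_mul_le[of "word_matrix A w" "word_matrix A v"] N[OF vw]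
        by (intro ln_mono) (auto simp: word_matrix_append)
      also have "\<dots> = ln (?N v) + ln (?N w)"
        using N[OF v] N[OF w] by (subst ln_mult) auto
      finally show "?P (v @ w) * ln (?N (v @ w)) \<le> ?P v * ?P w * (ln (?N v) + ln (?N w))"
        using P[of v] P[of w] by (simp add: mult_left_mono)
    qed
    \<comment> \<open>The double sum factors, and the pure weight sums are total probabilities,
      hence 1.\<close>
    also have "\<dots> = (\<Sum>v\<in>words m. ?P v * ln (?N v)) * (\<Sum>w\<in>words n. ?P w)
        + (\<Sum>v\<in>words m. ?P v) * (\<Sum>w\<in>words n. ?P w * ln (?N w))"
      unfolding sum_product by (simp add: sum.distrib[symmetric] algebra_simps)
    also have "\<dots> = a m + a n"
      by (simp only: sum_words_prob[OF p(3)] a_def mult_1_right mult_1_left)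
    finally show ?thesis .
  qed
  obtain L where L: "0 \<le> L" "(\<lambda>k. a k / real k) \<longlonglongrightarrow> L"
    using subadditive_quotient_tendsto[of a] sub nonneg by blast
  have "(\<Sum>w\<in>words k. ereal (?P w) * log_ext (?N w)) = ereal (a k)" for k
  proof -
    have "(\<Sum>w\<in>words k. ereal (?P w) * log_ext (?N w)) = (\<Sum>w\<in>words k. ereal (?P w * ln (?N w)))"
      using N by (intro sum.cong) (force simp: log_ext_def)+
    then show ?thesis by (simp add: a_def)
  qed
  then have "lyapunov_exponent p A = lim (\<lambda>k. ereal (a k / real k))"
    by (simp add: lyapunov_exponent_words)
  also have "\<dots> = ereal L"
    using L(2) by (intro limI) simp
  finally show ?thesis using L(1) by (simp add: lyapunov_radius_def)
qed

text \<open>Every word that extends \<open>w0\<close> also has product 0. So at each large length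
  some term of positive weight equals -\<infinity>, which makes the whole average
  -\<infinity>.\<close>

lemma lyapunov_radius_eq_0:
  fixes A :: "(real^'n^'n) \<times> (real^'n^'n)"
  assumes p: "0 < fst p" "0 < snd p"
    and w0: "set w0 \<subseteq> {1, 2}" "word_matrix A w0 = 0"
  shows "lyapunov_radius p A = 0"
proof -
  let ?P = "\<lambda>w. prod_list (map (pair_nth p) w)"
  let ?N = "\<lambda>w. onorm ((*v) (word_matrix A w))"
  \<comment> \<open>The bound \<open>Suc (length w0)\<close> excludes \<open>k = 0\<close>, where
    the factor \<open>1 / real k\<close> is 0 and would turn -\<infinity> into 0.\<close>
  have "ereal (1 / real k) * (\<Sum>w\<in>words k. ereal (?P w) * log_ext (?N w)) = -\<infinity>"
    if k: "k \<ge> Suc (length w0)" for k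
  proof -
    define w where "w = w0 @ replicate (k - length w0) 1"
    have w: "w \<in> words k" using w0 k by (auto simp: w_def words_def)
    have "word_matrix A w = 0" using w0(2) by (simp add: w_def word_matrix_append)
    then have "(*v) (word_matrix A w) = (\<lambda>v. 0)" by (simp add: fun_eq_iff)
    then have "?N w = 0" by (simp only: onorm_zero)
    then have "ereal (?P w) * log_ext (?N w) = -\<infinity>"
      using prob_word_pos[OF p, of w] by (simp add: log_ext_def)
    \<comment> \<open>In \<open>ereal\<close> the sum of \<infinity> and -\<infinity> is
      \<infinity>, so the remaining terms must be shown not to reach \<infinity>.\<close>
    moreover have "(\<Sum>w\<in>words k - {w}. ereal (?P w) * log_ext (?N w)) \<noteq> \<infinity>"
    proof (subst sum_Pinfty, rule notI, elim conjE bexE)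
      fix v assume "ereal (?P v) * log_ext (?N v) = \<infinity>"
      then show False using prob_word_pos[OF p, of v] by (simp add: log_ext_def split: if_splits)
    qed
    ultimately have "(\<Sum>w\<in>words k. ereal (?P w) * log_ext (?N w)) = -\<infinity>"
      using sum.remove[OF finite_words w, of "\<lambda>w. ereal (?P w) * log_ext (?N w)"]
      by (cases "\<Sum>w\<in>words k - {w}. ereal (?P w) * log_ext (?N w)") (simp_all only: plus_ereal.simps)
    then show ?thesis using k by simp
  qed
  then have "\<forall>\<^sub>F k in sequentially.
      ereal (1 / real k) * (\<Sum>w\<in>words k. ereal (?P w) * log_ext (?N w)) = -\<infinity>"
    unfolding eventually_sequentially by blast
  then have "lyapunov_exponent p A = -\<infinity>"
    unfolding lyapunov_exponent_words by (intro limI tendsto_eventually)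
  then show ?thesis by (simp add: lyapunov_radius_def)
qed

section \<open>Products of a rank-one matrix and a scaled rotation\<close>

text \<open>This isolates what the two dimensions share: \<open>x j\<close> is the starting vector
  rotated \<open>j\<close> times, the second matrix advances along this orbit, and the first one
  throws everything back to multiples of \<open>x 0\<close>.\<close>

locale rank_one_rotation =
  fixes A :: "(real^'n^'n) \<times> (real^'n^'n)"
    and f :: "real^'n" and x :: "nat \<Rightarrow> real^'n"
  assumes rank_one: "fst A *v v = (2 * (f \<bullet> v)) *\<^sub>R x 0"
    and orbit: "snd A *v x j = 2 *\<^sub>R x (Suc j)"
begin

text \<open>Each letter keeps the vector on a multiple of the orbit: letter 2 doubles it and
  advances \<open>j\<close>, letter 1 scales it by \<open>2 * \<bar>f \<bullet> x j\<bar>\<close>,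
  at least 1 in size, and resets \<open>j\<close> to 0. Hence the induction runs over all
  \<open>j\<close> at once.\<close>

lemma norm_word_ge:
  assumes norm_x: "\<And>j. norm (x j) = norm (x 0)" and f: "\<And>j. 1 / 2 \<le> \<bar>f \<bullet> x j\<bar>"
    and w: "set w \<subseteq> {1, 2}"
  shows "norm (x 0) \<le> norm (word_matrix A w *v x j)"
  using w
proof (induction w arbitrary: j)
  case Nil
  then show ?case using norm_x[of j] by simp
next
  case (Cons d w)
  show ?case
  proof (cases "d = 1")
    case True
    have "norm (x 0) \<le> (2 * \<bar>f \<bullet> x j\<bar>) * norm (word_matrix A w *v x 0)"
      using mult_mono[of 1 "2 * \<bar>f \<bullet> x j\<bar>" "norm (x 0)"] Cons f[of j] by simp
    with True show ?thesis
      by (simp add: matrix_vector_mul_assoc[symmetric] pair_nth_def rank_one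
          matrix_vector_mult_scaleR abs_mult)
  next
    case False
    have "norm (x 0) \<le> 2 * norm (word_matrix A w *v x (Suc j))"
      using Cons.IH[of "Suc j"] Cons.prems norm_ge_zero[of "x 0"] by (simp, linarith)
    with False show ?thesis
      by (simp add: matrix_vector_mul_assoc[symmetric] pair_nth_def orbit
          matrix_vector_mult_scaleR)
  qed
qed

text \<open>After the first letter 1 the image is spanned by \<open>x 0\<close>; the letters 2 carry
  it to a multiple of \<open>x k\<close>, which the last letter 1 annihilates.\<close>

lemma word_eq_0:
  assumes "f \<bullet> x k = 0"
  shows "word_matrix A (1 # replicate k 2 @ [1]) = 0"
proof -
  have pow: "word_matrix A (replicate k 2) *v x j = 2 ^ k *\<^sub>R x (j + k)" for j k
    by (induction k arbitrary: j)
      (auto simp: matrix_vector_mul_assoc[symmetric] pair_nth_def orbit matrix_vector_mult_scaleR)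
  have "word_matrix A (1 # replicate k 2 @ [1]) *v v = 0" for v
    using assms by (simp add: word_matrix_append matrix_vector_mul_assoc[symmetric] pair_nth_def
        rank_one matrix_vector_mult_scaleR pow)
  then show ?thesis unfolding matrix_eq by simp
qed

end

section \<open>From a jump of the radius to the gap\<close>

text \<open>Along \<open>B\<close> the radius is 0, so \<open>\<phi>\<close> is at most 0 there;
  continuity carries this bound to \<open>Abar\<close>, where the radius is at least 1.\<close>

lemma lower_bound_le_radius_minus_1:
  fixes \<phi> :: "(real^'n^'n) \<times> (real^'n^'n) \<Rightarrow> real"
  assumes cont: "continuous (at Abar within S) \<phi>"
    and le: "\<And>A. A \<in> S \<Longrightarrow> \<phi> A \<le> lyapunov_radius p A"
    and B: "B \<longlonglongrightarrow> Abar" "\<And>m. B m \<in> S" "\<And>m. lyapunov_radius p (B m) = 0"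
    and ge: "1 \<le> lyapunov_radius p Abar"
  shows "\<phi> Abar \<le> lyapunov_radius p Abar - 1"
proof -
  have "(\<lambda>m. \<phi> (B m)) \<longlonglongrightarrow> \<phi> Abar"
    using cont B by (simp add: continuous_within_sequentially o_def)
  moreover have "\<phi> (B m) \<le> 0" for m
    using le[of "B m"] B by simp
  ultimately have "\<phi> Abar \<le> 0"
    by (intro LIMSEQ_le_const2) auto
  with ge show ?thesis by simp
qed

section \<open>Angles near a third of pi\<close>

text \<open>The perturbation is tuned so that \<open>3 * (m + 2)\<close> steps of this angle end at
  an odd multiple of \<open>pi / 2\<close>. The shift by 2 keeps the doubled angle strictly below
  \<open>pi\<close>, so that its sine does not vanish.\<close>

definition angle :: "nat \<Rightarrow> real"
  where "angle m = pi / 3 + pi / (6 * real (m + 2))"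

lemma angle_tendsto: "angle \<longlonglongrightarrow> pi / 3"
proof -
  have "(\<lambda>m. inverse (real (m + 2))) \<longlonglongrightarrow> 0"
    by (rule LIMSEQ_ignore_initial_segment[OF lim_inverse_n])
  then have "(\<lambda>m. pi / 3 + (pi / 6) * inverse (real (m + 2))) \<longlonglongrightarrow> pi / 3 + (pi / 6) * 0"
    by (intro tendsto_intros)
  then show ?thesis by (simp add: angle_def[abs_def] field_simps)
qed

lemma angle_bounds: "0 < angle m" "2 * angle m < pi"
proof -
  have "pi / (6 * real (m + 2)) < pi / 6"
    by (intro divide_strict_left_mono) auto
  moreover have "2 * (pi / 3 + y) < pi" if "y < pi / 6" for y using that by simp
  ultimately show "2 * angle m < pi" unfolding angle_def by blast
  show "0 < angle m" unfolding angle_def by (intro add_pos_pos divide_pos_pos) auto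
qed

lemma cos_angle_zero: "cos (real (3 * (m + 2)) * angle m) = 0"
proof -
  have "real (3 * (m + 2)) * angle m = pi / 2 + real (m + 2) * pi"
    by (simp add: angle_def field_simps)
  moreover have "sin (real (m + 2) * pi) = 0" by (rule sin_npi)
  ultimately show ?thesis by (simp only: cos_add cos_pi_half sin_pi_half)
qed

text \<open>The triple-angle polynomial of the cosine \<open>c\<close> takes the value 1 or -1. The
  square of that polynomial minus 1 factors as
  \<open>(c\<^sup>2 - 1) * (4 * c\<^sup>2 - 1)\<^sup>2\<close>, so \<open>c\<^sup>2\<close> is 1 or
  1/4.\<close>

lemma cos_third_ge: "1 / 2 \<le> \<bar>cos (real j * (pi / 3))\<bar>"
proof -
  let ?c = "cos (real j * (pi / 3))"
  have "4 * ?c ^ 3 - 3 * ?c = cos (3 * (real j * (pi / 3)))"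
    by (rule cos_treble_cos[symmetric])
  also have "\<dots> = (- 1) ^ j" by simp
  finally have "(4 * ?c ^ 3 - 3 * ?c)\<^sup>2 = 1" by (simp only:) (simp add: power2_eq_square)
  then have "(?c\<^sup>2 - 1) * (4 * ?c\<^sup>2 - 1)\<^sup>2 = 0"
    by algebra
  then have "(1 / 2)\<^sup>2 \<le> ?c\<^sup>2" by (auto simp: power2_eq_square)
  then show ?thesis using abs_le_square_iff[of "1 / 2" ?c] by simp
qed

section \<open>The planar pair\<close>

definition planar_pair :: "real \<Rightarrow> (real^2^2) \<times> (real^2^2)"
  where "planar_pair t =
    (vector [vector [2, 0], vector [0, 0]],
     vector [vector [2 * cos t, - 2 * sin t], vector [2 * sin t, 2 * cos t]])"

lemma planar_pair_simps:
  "fst (planar_pair t) *v v = vector [2 * v $ 1, 0]"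
  "snd (planar_pair t) *v v =
    vector [2 * (cos t * v $ 1 - sin t * v $ 2), 2 * (sin t * v $ 1 + cos t * v $ 2)]"
  by (simp_all add: planar_pair_def vec_eq_iff forall_2 matrix_vector_mult_def sum_2 algebra_simps)

lemma planar_pair_tendsto:
  assumes "t \<longlonglongrightarrow> s"
  shows "(\<lambda>m. planar_pair (t m)) \<longlonglongrightarrow> planar_pair s"
  unfolding planar_pair_def
  apply (intro tendsto_Pair tendsto_const, (rule vec_tendstoI)+)
  subgoal for i j
    using exhaust_2[of i] exhaust_2[of j] assms
    by (auto intro!: tendsto_mult_left tendsto_minus tendsto_cos tendsto_sin)
  done

definition planar_orbit :: "real \<Rightarrow> nat \<Rightarrow> real^2"
  where "planar_orbit t j = vector [cos (real j * t), sin (real j * t)]"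

lemma rank_one_rotation_planar:
  "rank_one_rotation (planar_pair t) (vector [1, 0]) (planar_orbit t)"
  by unfold_locales
    (simp_all add: planar_pair_simps planar_orbit_def vec_eq_iff forall_2 inner_vec_def sum_2
      distrib_right cos_add sin_add algebra_simps)

text \<open>A rotation with nonzero sine fixes no line: an invariant subspace containing
  \<open>v\<close> also contains the quarter turn of \<open>v\<close>, and the two span the
  plane.\<close>

lemma nonfactorable_planar:
  assumes "sin t \<noteq> 0"
  shows "nonfactorable (planar_pair t)"
  unfolding nonfactorable_def
proof (intro allI impI, elim conjE)
  fix V assume V: "subspace V" and inv: "(*v) (snd (planar_pair t)) ` V \<subseteq> V"
  show "V = {0} \<or> V = UNIV"
  proof (cases "V \<subseteq> {0}")
    case True
    then show ?thesis using subspace_0[OF V] by auto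
  next
    case False
    then obtain v where v: "v \<in> V" "v \<noteq> 0" by auto
    \<comment> \<open>Subtracting the cosine part of the rotation and dividing by the sine leaves
      the quarter turn of \<open>v\<close>.\<close>
    define w where "w = (1 / (2 * sin t)) *\<^sub>R (snd (planar_pair t) *v v - (2 * cos t) *\<^sub>R v)"
    have w: "w \<in> V" unfolding w_def
      using V inv v by (intro subspace_scale subspace_diff) auto
    have w_eq: "w $ 1 = - v $ 2" "w $ 2 = v $ 1"
      using assms by (simp_all add: w_def planar_pair_simps)
    have nz: "v $ 1 * v $ 1 + v $ 2 * v $ 2 \<noteq> 0"
      using v(2) by (simp add: sum_squares_eq_zero_iff vec_eq_iff forall_2)
    have "y \<in> V" for y
    proof -
      let ?r = "v $ 1 * v $ 1 + v $ 2 * v $ 2"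
      \<comment> \<open>This is the expansion in the orthogonal basis \<open>v\<close>,
        \<open>w\<close>, both of squared length \<open>?r\<close>.\<close>
      have "y = ((y \<bullet> v) / ?r) *\<^sub>R v + ((y \<bullet> w) / ?r) *\<^sub>R w"
        using nz by (simp add: vec_eq_iff forall_2 inner_vec_def sum_2 w_eq divide_simps) algebra
      also have "\<dots> \<in> V" using V v w by (intro subspace_add subspace_scale)
      finally show ?thesis .
    qed
    then show ?thesis by auto
  qed
qed

section \<open>The spatial pair\<close>

definition spatial_pair :: "real \<Rightarrow> (real^3^3) \<times> (real^3^3)"
  where "spatial_pair t =
    (vector [vector [2, 0, 2], vector [0, 0, 0], vector [2, 0, 2]],
     vector [vector [2 * cos t, - 2 * sin t, 0], vector [2 * sin t, 2 * cos t, 0],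
       vector [0, 0, 2]])"

lemma spatial_pair_simps:
  "fst (spatial_pair t) *v v = vector [2 * (v $ 1 + v $ 3), 0, 2 * (v $ 1 + v $ 3)]"
  "snd (spatial_pair t) *v v =
    vector [2 * (cos t * v $ 1 - sin t * v $ 2), 2 * (sin t * v $ 1 + cos t * v $ 2), 2 * v $ 3]"
  by (simp_all add: spatial_pair_def vec_eq_iff forall_3 matrix_vector_mult_def sum_3 algebra_simps)

lemma spatial_pair_tendsto:
  assumes "t \<longlonglongrightarrow> s"
  shows "(\<lambda>m. spatial_pair (t m)) \<longlonglongrightarrow> spatial_pair s"
  unfolding spatial_pair_def
  apply (intro tendsto_Pair tendsto_const, (rule vec_tendstoI)+)
  subgoal for i j
    using exhaust_3[of i] exhaust_3[of j] assms
    by (auto intro!: tendsto_mult_left tendsto_minus tendsto_cos tendsto_sin)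
  done

definition spatial_orbit :: "real \<Rightarrow> nat \<Rightarrow> real^3"
  where "spatial_orbit t j = vector [cos (real j * t), sin (real j * t), 1]"

lemma rank_one_rotation_spatial:
  "rank_one_rotation (spatial_pair t) (vector [1, 0, 1]) (spatial_orbit t)"
  by unfold_locales
    (simp_all add: spatial_pair_simps spatial_orbit_def vec_eq_iff forall_3 inner_vec_def sum_3
      distrib_right cos_add sin_add algebra_simps)

text \<open>The half-angle formula for \<open>1 + cos\<close> reduces the spatial case to the planar
  cosines. This is why the spatial pair is used at doubled angles.\<close>

lemma inner_spatial_orbit:
  "vector [1, 0, 1] \<bullet> spatial_orbit (2 * t) j = 2 * (cos (real j * t))\<^sup>2"
  using cos_double_cos[of "real j * t"]
  by (simp add: spatial_orbit_def inner_vec_def sum_3 mult.left_commute)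

text \<open>A nonzero invariant subspace must contain \<open>?u\<close>, the range vector of the
  first matrix; the rotated copies of \<open>?u\<close> then generate the rotation axis and the
  plane orthogonal to it.\<close>

lemma nonfactorable_spatial:
  assumes s: "sin t \<noteq> 0"
  shows "nonfactorable (spatial_pair t)"
  unfolding nonfactorable_def
proof (intro allI impI, elim conjE)
  fix V assume V: "subspace V" and inv1: "(*v) (fst (spatial_pair t)) ` V \<subseteq> V"
    and inv2: "(*v) (snd (spatial_pair t)) ` V \<subseteq> V"
  define R where "R v = (1 / 2) *\<^sub>R (snd (spatial_pair t) *v v)" for v
  have R: "R v \<in> V" if "v \<in> V" for v
    unfolding R_def using V inv2 that by (intro subspace_scale) auto
  have R_eq: "R v $ 1 = cos t * v $ 1 - sin t * v $ 2" "R v $ 2 = sin t * v $ 1 + cos t * v $ 2"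
    "R v $ 3 = v $ 3" for v
    by (simp_all add: R_def spatial_pair_simps)
  have pyth: "sin t * sin t = 1 - cos t * cos t"
    using sin_cos_squared_add[of t] by (simp add: power2_eq_square)
  have c: "cos t \<noteq> 1" using pyth s by auto
  let ?u = "vector [1, 0, 1] :: real^3"
  have u: "?u \<in> V" if "v \<in> V" "v $ 1 + v $ 3 \<noteq> 0" for v
  proof -
    have "?u = (1 / (2 * (v $ 1 + v $ 3))) *\<^sub>R (fst (spatial_pair t) *v v)"
      using that by (simp add: spatial_pair_simps vec_eq_iff forall_3)
    also have "\<dots> \<in> V" using V inv1 that by (intro subspace_scale) auto
    finally show ?thesis .
  qed
  show "V = {0} \<or> V = UNIV"
  proof (cases "V \<subseteq> {0}")
    case True
    then show ?thesis using subspace_0[OF V] by auto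
  next
    case False
    then obtain v where v: "v \<in> V" "v \<noteq> 0" by auto
    have uV: "?u \<in> V"
    proof (rule ccontr)
      assume "?u \<notin> V"
      then have 1: "v $ 1 + v $ 3 = 0" and 2: "R v $ 1 + R v $ 3 = 0"
        and 3: "R (R v) $ 1 + R (R v) $ 3 = 0"
        using u v R by blast+
      \<comment> \<open>The planar parts of \<open>v\<close>, \<open>R v\<close> and
        \<open>R (R v)\<close> lie on one circle and have equal first coordinate. A line meets a
        circle of positive radius in at most two points, and these three would be distinct since
        \<open>sin t\<close> is nonzero, so the circle degenerates; the elimination expresses
        this.\<close>
      have "v $ 1 * (1 - cos t) = 0" using 1 2 3 pyth s unfolding R_eq by algebra
      then have "v $ 1 = 0" using c by simp
      moreover from this have "v $ 3 = 0" "v $ 2 = 0" using 1 2 s by (auto simp: R_eq)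
      ultimately show False using v(2) by (simp add: vec_eq_iff forall_3)
    qed
    have axis: "axis 3 1 \<in> V"
    proof -
      \<comment> \<open>The characteristic polynomial of the planar rotation, applied to
        \<open>R\<close>, kills the first two coordinates and multiplies the third by
        \<open>2 - 2 * cos t\<close>.\<close>
      have "axis 3 1 = (1 / (2 - 2 * cos t)) *\<^sub>R (R (R ?u) - (2 * cos t) *\<^sub>R R ?u + ?u)"
        using c pyth by (simp add: vec_eq_iff forall_3 R_eq axis_def)
      also have "\<dots> \<in> V" using V uV R by (intro subspace_scale subspace_add subspace_diff) auto
      finally show ?thesis .
    qed
    have "y \<in> V" for y
    proof -
      \<comment> \<open>Removing the axis part from \<open>?u\<close> and \<open>R ?u\<close> leaves
        \<open>(1, 0, 0)\<close> and \<open>(cos t, sin t, 0)\<close>, a basis of the horizontal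
        plane.\<close>
      have "y = (y $ 1 - y $ 2 * cos t / sin t) *\<^sub>R (?u - axis 3 1)
          + (y $ 2 / sin t) *\<^sub>R (R ?u - axis 3 1) + y $ 3 *\<^sub>R axis 3 1"
        using s by (simp add: vec_eq_iff forall_3 R_eq axis_def)
      also have "\<dots> \<in> V" using V uV axis R by (intro subspace_add subspace_diff subspace_scale)
      finally show ?thesis .
    qed
    then show ?thesis by auto
  qed
qed

section \<open>The invariant circular cone\<close>

text \<open>This is the circular cone $x^2 + y^2 \le z^2$, $z \ge 0$, as an intersection of half-spaces.\<close>

definition circular_cone :: "(real^3) set"
  where "circular_cone = {v. \<forall>a. cos a * v $ 1 + sin a * v $ 2 \<le> v $ 3}"

lemma circular_cone_abs_le:
  assumes "v \<in> circular_cone"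
  shows "\<bar>v $ 1\<bar> \<le> v $ 3" "\<bar>v $ 2\<bar> \<le> v $ 3"
proof -
  have v: "cos a * v $ 1 + sin a * v $ 2 \<le> v $ 3" for a
    using assms by (simp add: circular_cone_def)
  show "\<bar>v $ 1\<bar> \<le> v $ 3" using v[of 0] v[of pi] by simp
  show "\<bar>v $ 2\<bar> \<le> v $ 3" using v[of "pi / 2"] v[of "- (pi / 2)"] by simp
qed

lemma proper_cone_circular: "proper_cone circular_cone"
  unfolding proper_cone_def
proof (intro conjI)
  show "cone circular_cone"
    unfolding cone_def circular_cone_def
  proof (clarsimp)
    fix v :: "real^3" and r a :: real
    assume "\<forall>a. cos a * v $ 1 + sin a * v $ 2 \<le> v $ 3" "0 \<le> r"
    then have "r * (cos a * v $ 1 + sin a * v $ 2) \<le> r * v $ 3" by (simp add: mult_left_mono)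
    then show "cos a * (r * v $ 1) + sin a * (r * v $ 2) \<le> r * v $ 3" by (simp add: algebra_simps)
  qed
  have eq: "circular_cone = (\<Inter>a. {v. vector [cos a, sin a, -1] \<bullet> v \<le> 0})"
    by (auto simp: circular_cone_def inner_vec_def sum_3)
  show "convex circular_cone"
    unfolding eq by (intro convex_INT convex_halfspace_le)
  show "closed circular_cone"
    unfolding eq by (intro closed_INT ballI closed_halfspace_le)
  \<comment> \<open>On this ball the left side of each defining inequality is at most 1/4 + 1/4,
    while \<open>v $ 3\<close> is at least 3/4.\<close>
  have "ball (axis 3 1) (1 / 4) \<subseteq> circular_cone"
  proof
    fix v :: "real^3" assume "v \<in> ball (axis 3 1) (1 / 4)"
    then have "\<bar>(v - axis 3 1) $ i\<bar> \<le> 1 / 4" for i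
      using component_le_norm_cart[of "v - axis 3 1" i] by (simp add: dist_norm norm_minus_commute)
    from this[of 1] this[of 2] this[of 3]
    have v: "\<bar>v $ 1\<bar> \<le> 1 / 4" "\<bar>v $ 2\<bar> \<le> 1 / 4" "\<bar>v $ 3 - 1\<bar> \<le> 1 / 4"
      by (simp_all add: axis_def)
    have "cos a * v $ 1 + sin a * v $ 2 \<le> v $ 3" for a
    proof -
      have "\<bar>cos a * v $ 1\<bar> \<le> 1 * (1 / 4)" "\<bar>sin a * v $ 2\<bar> \<le> 1 * (1 / 4)"
        unfolding abs_mult using v by (intro mult_mono; simp)+
      then show ?thesis using v by linarith
    qed
    then show "v \<in> circular_cone" by (simp add: circular_cone_def)
  qed
  then have "axis 3 1 \<in> interior circular_cone"
    unfolding mem_interior by (intro exI[of _ "1 / 4"]) simp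
  then show "interior circular_cone \<noteq> {}" by auto
  have "v = 0" if "v \<in> circular_cone" "- v \<in> circular_cone" for v
    using circular_cone_abs_le[OF that(1)] circular_cone_abs_le[OF that(2)]
    by (auto simp: vec_eq_iff forall_3 abs_le_iff)
  moreover have "0 \<in> circular_cone" by (simp add: circular_cone_def)
  ultimately show "circular_cone \<inter> uminus ` circular_cone = {0}" by force
qed

text \<open>The first matrix has a nonnegative coefficient on the cone and maps into the ray through
  \<open>(1, 0, 1)\<close>, a boundary ray. The rotation permutes the defining half-spaces,
  replacing \<open>a\<close> by \<open>a - t\<close>.\<close>

lemma shares_cone_spatial: "shares_cone circular_cone (spatial_pair t)"
  unfolding shares_cone_def
proof (intro conjI subsetI; elim imageE; hypsubst)
  fix v assume v: "v \<in> circular_cone"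
  have nonneg: "0 \<le> 2 * (v $ 1 + v $ 3)" using circular_cone_abs_le(1)[OF v] by auto
  have "cos a * (2 * (v $ 1 + v $ 3)) \<le> 2 * (v $ 1 + v $ 3)" for a
    using mult_right_mono[OF cos_le_one nonneg] by simp
  then show "fst (spatial_pair t) *v v \<in> circular_cone"
    by (simp add: circular_cone_def spatial_pair_simps)
  have "cos a * (2 * (cos t * v $ 1 - sin t * v $ 2)) + sin a * (2 * (sin t * v $ 1 + cos t * v $ 2))
      = 2 * (cos (a - t) * v $ 1 + sin (a - t) * v $ 2)" for a
    by (simp add: cos_diff sin_diff algebra_simps)
  moreover have "2 * (cos (a - t) * v $ 1 + sin (a - t) * v $ 2) \<le> 2 * v $ 3" for a
    using v by (intro mult_left_mono) (simp_all add: circular_cone_def)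
  ultimately show "snd (spatial_pair t) *v v \<in> circular_cone"
    by (simp only: circular_cone_def spatial_pair_simps mem_Collect_eq vector_3 simp_thms)
qed

section \<open>The two witnesses and their approximating pairs\<close>

theorem theorem4:
  fixes p1 p2 :: real
  assumes "p1 > 0" and "p2 > 0" and "p1 + p2 = 1"
  shows
    "(\<exists>Abar :: (real^2^2) \<times> (real^2^2).
        nonfactorable Abar \<and>
        (\<forall>\<phi> :: (real^2^2) \<times> (real^2^2) \<Rightarrow> real.
           continuous (at Abar within {A. nonfactorable A}) \<phi> \<and>
           (\<forall>A. nonfactorable A \<longrightarrow> \<phi> A \<le> lyapunov_radius (p1, p2) A)
           \<longrightarrow> \<phi> Abar \<le> lyapunov_radius (p1, p2) Abar - 1)) \<and>
     (\<exists>(K :: (real^3) set) (Abar :: (real^3^3) \<times> (real^3^3)).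
        proper_cone K \<and> nonfactorable Abar \<and> shares_cone K Abar \<and>
        (\<forall>\<phi> :: (real^3^3) \<times> (real^3^3) \<Rightarrow> real.
           continuous (at Abar within {A. nonfactorable A \<and> shares_cone K A}) \<phi> \<and>
           (\<forall>A. nonfactorable A \<and> shares_cone K A \<longrightarrow> \<phi> A \<le> lyapunov_radius (p1, p2) A)
           \<longrightarrow> \<phi> Abar \<le> lyapunov_radius (p1, p2) Abar - 1))"
proof (intro conjI exI)
  \<comment> \<open>The existential witnesses are still schematic and get fixed by the
    \<open>show\<close> commands: the planar pair at \<open>pi / 3\<close>, and the circular cone
    with the spatial pair at \<open>2 * (pi / 3)\<close>.\<close>
  let ?p = "(p1, p2)"
  have p: "0 < fst ?p" "0 < snd ?p" "fst ?p + snd ?p = 1" using assms by simp_all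
  have word: "set (1 # replicate k 2 @ [1 :: nat]) \<subseteq> {1, 2}" for k by auto
  have sin_angle: "sin (angle m) \<noteq> 0" "sin (2 * angle m) \<noteq> 0" for m
    using angle_bounds[of m] sin_gt_zero[of "angle m"] sin_gt_zero[of "2 * angle m"] by auto
  have sin_limit: "sin (pi / 3) \<noteq> 0" "sin (2 * (pi / 3)) \<noteq> 0"
    using sin_gt_zero[of "pi / 3"] sin_gt_zero[of "2 * (pi / 3)"] pi_gt_zero by simp_all

  show planar: "nonfactorable (planar_pair (pi / 3))"
    by (rule nonfactorable_planar) (rule sin_limit)
  have planar_ge: "1 \<le> lyapunov_radius ?p (planar_pair (pi / 3))"
  proof (rule lyapunov_radius_ge_1[OF p])
    show "planar_orbit (pi / 3) 0 \<noteq> 0"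
      by (simp add: planar_orbit_def vec_eq_iff forall_2)
    fix w :: "nat list" assume "set w \<subseteq> {1, 2}"
    then show "norm (planar_orbit (pi / 3) 0)
        \<le> norm (word_matrix (planar_pair (pi / 3)) w *v planar_orbit (pi / 3) 0)"
      using cos_third_ge
      by (intro rank_one_rotation.norm_word_ge[OF rank_one_rotation_planar])
        (simp_all add: planar_orbit_def norm_vec_def L2_set_def inner_vec_def sum_2)
  qed
  have planar_zero: "lyapunov_radius ?p (planar_pair (angle m)) = 0" for m
    by (rule lyapunov_radius_eq_0[OF p(1,2) word],
        rule rank_one_rotation.word_eq_0[OF rank_one_rotation_planar, where k = "3 * (m + 2)"])
      (use cos_angle_zero[of m] in \<open>simp add: planar_orbit_def inner_vec_def sum_2\<close>)
  show "\<forall>\<phi> :: (real^2^2) \<times> (real^2^2) \<Rightarrow> real.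
      continuous (at (planar_pair (pi / 3)) within {A. nonfactorable A}) \<phi> \<and>
      (\<forall>A. nonfactorable A \<longrightarrow> \<phi> A \<le> lyapunov_radius ?p A)
      \<longrightarrow> \<phi> (planar_pair (pi / 3)) \<le> lyapunov_radius ?p (planar_pair (pi / 3)) - 1"
    using planar_ge planar_zero nonfactorable_planar[OF sin_angle(1)]
    by (intro allI impI, elim conjE)
      (rule lower_bound_le_radius_minus_1[OF _ _ planar_pair_tendsto[OF angle_tendsto]], auto)

  show "proper_cone circular_cone" by (rule proper_cone_circular)
  show "nonfactorable (spatial_pair (2 * (pi / 3)))"
    by (rule nonfactorable_spatial) (rule sin_limit)
  show "shares_cone circular_cone (spatial_pair (2 * (pi / 3)))"
    by (rule shares_cone_spatial)
  \<comment> \<open>Squaring the cosine bound gives 1/4, and the factor 2 in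
    \<open>inner_spatial_orbit\<close> restores the 1/2 that \<open>norm_word_ge\<close>
    requires.\<close>
  have f: "1 / 2 \<le> \<bar>vector [1, 0, 1] \<bullet> spatial_orbit (2 * (pi / 3)) j\<bar>" for j
    using power_mono[OF cos_third_ge[of j], of 2]
    unfolding inner_spatial_orbit by (simp add: power_divide)
  have spatial_ge: "1 \<le> lyapunov_radius ?p (spatial_pair (2 * (pi / 3)))"
  proof (rule lyapunov_radius_ge_1[OF p])
    show "spatial_orbit (2 * (pi / 3)) 0 \<noteq> 0"
      by (simp add: spatial_orbit_def vec_eq_iff forall_3)
    fix w :: "nat list" assume "set w \<subseteq> {1, 2}"
    then show "norm (spatial_orbit (2 * (pi / 3)) 0)
        \<le> norm (word_matrix (spatial_pair (2 * (pi / 3))) w *v spatial_orbit (2 * (pi / 3)) 0)"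
      using f by (intro rank_one_rotation.norm_word_ge[OF rank_one_rotation_spatial])
        (simp_all add: spatial_orbit_def norm_vec_def L2_set_def sum_3)
  qed
  have spatial_zero: "lyapunov_radius ?p (spatial_pair (2 * angle m)) = 0" for m
    by (rule lyapunov_radius_eq_0[OF p(1,2) word],
        rule rank_one_rotation.word_eq_0[OF rank_one_rotation_spatial, where k = "3 * (m + 2)"])
      (use cos_angle_zero[of m] in \<open>simp add: inner_spatial_orbit\<close>)
  have "(\<lambda>m. 2 * angle m) \<longlonglongrightarrow> 2 * (pi / 3)"
    by (intro tendsto_intros angle_tendsto)
  note lim = spatial_pair_tendsto[OF this]
  show "\<forall>\<phi> :: (real^3^3) \<times> (real^3^3) \<Rightarrow> real.
      continuous (at (spatial_pair (2 * (pi / 3))) within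
        {A. nonfactorable A \<and> shares_cone circular_cone A}) \<phi> \<and>
      (\<forall>A. nonfactorable A \<and> shares_cone circular_cone A \<longrightarrow> \<phi> A \<le> lyapunov_radius ?p A)
      \<longrightarrow> \<phi> (spatial_pair (2 * (pi / 3))) \<le> lyapunov_radius ?p (spatial_pair (2 * (pi / 3))) - 1"
    using spatial_ge spatial_zero nonfactorable_spatial[OF sin_angle(2)] shares_cone_spatial
    by (intro allI impI, elim conjE)
      (rule lower_bound_le_radius_minus_1[OF _ _ lim], auto)
qed

end
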